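(* Let $n\ge 2$, let $\Phi$ be a radial function on $\mathbb{R}^n$, and let $1\le p,\tilde p_1,\tilde p_2<\infty$. Then, for every $f\in L^{p}_{\rm rad}L^{\tilde p_2}_{\rm ang}(\mathbb{R}^n)$, $$\|H_{\Phi}f\|_{L^{p}_{\rm rad}L^{\tilde p_1}_{\rm ang}(\mathbb{R}^n)}\le \omega_{n-1}^{\frac{1}{\tilde p_1}+\frac{1}{\tilde p_2'}}\int_0^\infty \frac{|\Phi(t)|}{t}\,t^{\frac{n}{p}}\,dt\;\|f\|_{L^{p}_{\rm rad}L^{\tilde p_2}_{\rm ang}(\mathbb{R}^n)} .$$
   Context: $S^{n-1}$ is the unit sphere of $\mathbb{R}^n$ with (unnormalized) surface Lebesgue measure $d\sigma$, and $\omega_{n-1}=\sigma(S^{n-1})$. For $1\le p,\tilde p<\infty$, $$\|f\|_{L^{p}_{\rm rad}L^{\tilde p}_{\rm ang}(\mathbb{R}^n)}=\Big(\int_0^\infty\Big(\int_{S^{n-1}}|f(r\theta)|^{\tilde p}d\sigma(\theta)\Big)^{p/\tilde p}r^{n-1}dr\Big)^{1/p},$$ and the space consists of the measurable $f$ with finite norm. The Hausdorff operator is $$H_\Phi f(x)=\int_{\mathbb{R}^n}\frac{\Phi(x|y|^{-1})}{|y|^n}f(y)\,dy .$$ $\Phi$ is measurable; radial means $\Phi(x)$ depends only on $|x|$, and one writes $\Phi(t)$, $t>0$, for its value at points with $|x|=t$. $\tilde p_2'$ is the conjugate exponent: $1/\tilde p_2+1/\tilde p_2'=1$. The inequality has content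 when the integral constant on the right is finite. *)

theory Defs
  imports "HOL-Analysis.Analysis"
begin

text \<open>
  Surface measure on the unit sphere, normalised by
  \<open>\<sigma>(A) = d \<cdot> |{r \<theta>. 0 < r < 1, \<theta> \<in> A}|\<close> with \<open>d\<close> the dimension of the ambient space;
  note that \<open>sgn x = x / |x|\<close>. This is the measure for which integration in polar coordinates
  reads \<open>dx = r\<^sup>d\<^sup>-\<^sup>1 dr d\<sigma>\<close>.
\<close>
definition sphere_measure :: "'a::euclidean_space measure" where
  "sphere_measure =
     scale_measure (of_nat DIM('a))
       (distr (restrict_space lborel (ball 0 1 - {0})) (restrict_space borel (sphere 0 1)) sgn)"

lemma space_sphere_measure: "space (sphere_measure :: 'a::euclidean_space measure) = sphere 0 1"
  by (simp add: sphere_measure_def space_scale_measure space_restrict_space)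

lemma sgn_measurable_sphere:
  "sgn \<in> restrict_space lborel (ball 0 1 - {0}) \<rightarrow>\<^sub>M
     restrict_space borel (sphere (0::'a::euclidean_space) 1)"
proof -
  have "continuous_on (ball 0 1 - {0::'a}) sgn"
    by (intro continuous_intros) auto
  then have "sgn \<in> restrict_space borel (ball 0 1 - {0::'a}) \<rightarrow>\<^sub>M borel"
    by (rule borel_measurable_continuous_on_restrict)
  then have "sgn \<in> restrict_space lborel (ball 0 1 - {0::'a}) \<rightarrow>\<^sub>M borel"
    by (simp add: measurable_def sets_restrict_space space_restrict_space)
  then show ?thesis
    by (intro measurable_restrict_space2) (auto simp: space_restrict_space norm_sgn)
qed

lemma emeasure_sphere_measure:
  fixes A :: "'a::euclidean_space set"
  assumes "A \<in> sets borel" "A \<subseteq> sphere 0 1"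
  shows "emeasure sphere_measure A =
           of_nat DIM('a) * emeasure lborel {x \<in> ball 0 1 - {0}. sgn x \<in> A}"
proof -
  have A: "A \<in> sets (restrict_space borel (sphere 0 1))"
    using assms by (auto simp: sets_restrict_space)
  have "sgn -` A \<inter> (ball 0 1 - {0}) = {x \<in> ball 0 1 - {0}. sgn x \<in> A}"
    by auto
  moreover have "emeasure (restrict_space lborel (ball 0 1 - {0})) {x \<in> ball 0 1 - {0}. sgn x \<in> A}
      = emeasure lborel {x \<in> ball 0 1 - {0}. sgn x \<in> A}"
    by (rule emeasure_restrict_space) auto
  ultimately show ?thesis
    using A
    by (simp add: sphere_measure_def emeasure_distr[OF sgn_measurable_sphere]
        space_restrict_space del: mem_ball)
qed

lemma emeasure_sphere_measure_UNIV:
  "emeasure (sphere_measure :: 'a::euclidean_space measure) (sphere 0 1) =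
     ennreal (DIM('a) * unit_ball_vol DIM('a))"
proof -
  have "{x \<in> ball 0 1 - {0}. sgn x \<in> sphere (0::'a) 1} = ball 0 1 - {0}"
    by (auto simp: norm_sgn)
  moreover have "emeasure lborel (ball 0 1 - {0::'a}) = emeasure lborel (ball 0 1 :: 'a set)"
    by (rule emeasure_Diff_null_set) auto
  ultimately show ?thesis
    by (simp add: emeasure_sphere_measure emeasure_ball ennreal_mult ennreal_of_nat_eq_real_of_nat)
qed

text \<open>Only used for exponents \<open>a > 0\<close>, whence the value at infinity.\<close>
definition ennreal_powr :: "ennreal \<Rightarrow> real \<Rightarrow> ennreal" where
  "ennreal_powr x a = (if x = \<infinity> then \<infinity> else ennreal (enn2real x powr a))"

definition radang_norm :: "real \<Rightarrow> real \<Rightarrow> ('a::euclidean_space \<Rightarrow> complex) \<Rightarrow> ennreal" where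
  "radang_norm p q f =
     ennreal_powr
       (\<integral>\<^sup>+ r \<in> {0<..}.
          ennreal_powr (\<integral>\<^sup>+ \<theta>. ennreal (cmod (f (r *\<^sub>R \<theta>)) powr q) \<partial>sphere_measure) (p / q)
            * ennreal (r ^ (DIM('a) - 1)) \<partial>lebesgue)
       (1 / p)"

definition radang_space :: "real \<Rightarrow> real \<Rightarrow> ('a::euclidean_space \<Rightarrow> complex) set" where
  "radang_space p q = {f \<in> borel_measurable lebesgue. radang_norm p q f < \<infinity>}"

definition radial :: "('a::real_normed_vector \<Rightarrow> 'b) \<Rightarrow> bool" where
  "radial \<Phi> \<longleftrightarrow> (\<forall>x y. norm x = norm y \<longrightarrow> \<Phi> x = \<Phi> y)"

text \<open>For radial \<open>\<Phi>\<close> and \<open>t \<ge> 0\<close>, the choice of the point of norm \<open>t\<close> is immaterial.\<close>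
definition radial_value :: "('a::real_normed_vector \<Rightarrow> 'b) \<Rightarrow> real \<Rightarrow> 'b" where
  "radial_value \<Phi> t = \<Phi> (SOME x. norm x = t)"

definition hausdorff_kernel ::
    "('a::euclidean_space \<Rightarrow> complex) \<Rightarrow> 'a \<Rightarrow> 'a \<Rightarrow> complex" where
  "hausdorff_kernel \<Phi> x y = \<Phi> (x /\<^sub>R norm y) / complex_of_real (norm y ^ DIM('a))"

definition hausdorff_op ::
    "('a::euclidean_space \<Rightarrow> complex) \<Rightarrow> ('a \<Rightarrow> complex) \<Rightarrow> 'a \<Rightarrow> complex" where
  "hausdorff_op \<Phi> f x = (LINT y|lebesgue. hausdorff_kernel \<Phi> x y * f y)"

definition hausdorff_const :: "('a::euclidean_space \<Rightarrow> complex) \<Rightarrow> real \<Rightarrow> ennreal" where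
  "hausdorff_const \<Phi> p =
     (\<integral>\<^sup>+ t \<in> {0<..}. ennreal (cmod (radial_value \<Phi> t) / t * t powr (DIM('a) / p)) \<partial>lebesgue)"

end

theory Submission
  imports Defs
begin

text \<open>
  After passing to Borel representatives, polar coordinates give \<open>|H\<^sub>\<Phi> f x| \<le> K |x|\<close>, where
  \<open>K r = \<integral> |\<Phi> (r / s)| G s ds/s\<close> and \<open>G s\<close> is the integral of \<open>|f (s \<theta>)|\<close> over the sphere.
  Multiplied by \<open>r powr (n / p)\<close>, this is a convolution on the multiplicative group of positive
  reals with its Haar measure \<open>dt/t\<close>, and Young's inequality \<open>L\<^sup>1 * L\<^sup>p \<subseteq> L\<^sup>p\<close> bounds its norm.
  The powers of the area of the sphere come from the constant majorant \<open>K r\<close> on the sphere of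
  radius \<open>r\<close> and from Hoelder's inequality applied to \<open>G\<close>.
\<close>

subsection \<open>Powers and the power mean inequality\<close>

lemma ennreal_powr_ennreal: "0 \<le> x \<Longrightarrow> ennreal_powr (ennreal x) a = ennreal (x powr a)"
  by (simp add: ennreal_powr_def)

lemma ennreal_powr_top [simp]: "ennreal_powr top a = top"
  by (simp add: ennreal_powr_def)

lemma ennreal_powr_0 [simp]: "ennreal_powr 0 a = 0"
  by (simp add: ennreal_powr_def)

lemma ennreal_powr_1 [simp]: "ennreal_powr x 1 = x"
  by (cases x) (auto simp: ennreal_powr_ennreal)

lemma measurable_ennreal_powr [measurable]: "(\<lambda>x. ennreal_powr x a) \<in> borel_measurable borel"
  unfolding ennreal_powr_def[abs_def] by measurable

lemma ennreal_powr_mono: "x \<le> y \<Longrightarrow> 0 \<le> a \<Longrightarrow> ennreal_powr x a \<le> ennreal_powr y a"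
  by (cases x; cases y)
     (auto simp: ennreal_powr_ennreal top_unique intro!: ennreal_leI powr_mono2)

lemma ennreal_powr_eq_0_iff: "ennreal_powr x a = 0 \<longleftrightarrow> x = 0"
  by (cases x) (auto simp: ennreal_powr_ennreal)

lemma ennreal_powr_eq_top_iff: "ennreal_powr x a = top \<longleftrightarrow> x = top"
  by (cases x) (auto simp: ennreal_powr_ennreal)

lemma ennreal_powr_mult:
  assumes "0 < a"
  shows "ennreal_powr (x * y) a = ennreal_powr x a * ennreal_powr y a"
proof (cases "x = top \<or> y = top")
  case True
  then show ?thesis
    by (cases "x = 0 \<or> y = 0")
       (auto simp: ennreal_top_mult ennreal_mult_top ennreal_powr_eq_0_iff)
next
  case False
  then obtain u v where "x = ennreal u" "y = ennreal v" "0 \<le> u" "0 \<le> v"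
    by (metis ennreal_cases)
  then show ?thesis
    by (simp add: ennreal_powr_ennreal powr_mult flip: ennreal_mult)
qed

lemma ennreal_powr_powr: "ennreal_powr (ennreal_powr x a) b = ennreal_powr x (a * b)"
  by (cases x) (auto simp: ennreal_powr_ennreal powr_powr)

lemma le_powr_tangent:
  fixes x a p :: real
  assumes "0 \<le> x" "0 < a" "1 \<le> p"
  shows "x \<le> x powr p * (a powr (1 - p) / p) + a * (1 - 1 / p)"
proof (cases "x = 0")
  case False
  with assms have "((x / a) powr p) powr (1 / p) * 1 powr (1 - 1 / p)
      \<le> 1 / p * (x / a) powr p + (1 - 1 / p) * 1"
    by (intro Youngs_inequality_0) auto
  then have "x / a \<le> 1 / p * (x / a) powr p + (1 - 1 / p)"
    using assms False by (simp add: powr_powr)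
  then have "a * (x / a) \<le> a * (1 / p * (x / a) powr p + (1 - 1 / p))"
    using assms by (intro mult_left_mono) auto
  also have "\<dots> = x powr p * (a powr (1 - p) / p) + a * (1 - 1 / p)"
    using assms False by (simp add: powr_divide powr_diff field_simps)
  finally show ?thesis using assms by simp
qed (use assms in auto)

lemma nn_integral_powr_le:
  assumes h [measurable]: "h \<in> borel_measurable M"
    and p: "1 \<le> p" and fin: "emeasure M (space M) \<noteq> top"
  shows "ennreal_powr (\<integral>\<^sup>+x. h x \<partial>M) p
    \<le> ennreal_powr (emeasure M (space M)) (p - 1) * (\<integral>\<^sup>+x. ennreal_powr (h x) p \<partial>M)"
    (is "ennreal_powr ?H p \<le> ennreal_powr ?W _ * ?I")
proof -
  consider "?W = 0" | "?I = 0" | "?W \<noteq> 0" "?I = top"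
    | w i where "?W = ennreal w" "0 < w" "?I = ennreal i" "0 < i"
    by (metis ennreal_cases ennreal_0 fin le_less)
  then show ?thesis
  proof cases
    case 1
    then have "AE x in M. h x = 0"
      by (intro AE_I'[of "space M"]) auto
    then have "?H = 0"
      by (simp add: nn_integral_0_iff_AE)
    then show ?thesis by simp
  next
    case 2
    then have "AE x in M. ennreal_powr (h x) p = 0"
      by (subst (asm) nn_integral_0_iff_AE) auto
    then have "?H = 0"
      by (subst nn_integral_0_iff_AE) (auto simp: ennreal_powr_eq_0_iff)
    then show ?thesis by simp
  next
    case 3
    then show ?thesis by (simp add: ennreal_mult_top ennreal_powr_eq_0_iff)
  next
    case (4 w i)
    define a where "a = (i / w) powr (1 / p)"
    have a: "0 < a" "a powr p = i / w"
      using 4 p by (auto simp: a_def powr_powr)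
    have pt: "h x \<le> ennreal_powr (h x) p * ennreal (a powr (1 - p) / p) + ennreal (a * (1 - 1 / p))" for x
    proof (cases "h x")
      case (real y)
      then show ?thesis
        using le_powr_tangent[of y a p] p a
        by (simp add: ennreal_powr_ennreal ennreal_leI flip: ennreal_mult ennreal_plus)
    next
      case top
      then show ?thesis using a p by (simp add: ennreal_top_mult)
    qed
    have "?H \<le> (\<integral>\<^sup>+x. ennreal_powr (h x) p * ennreal (a powr (1 - p) / p) + ennreal (a * (1 - 1 / p)) \<partial>M)"
      by (intro nn_integral_mono pt)
    also have "\<dots> = ?I * ennreal (a powr (1 - p) / p) + ennreal (a * (1 - 1 / p)) * ?W"
      by (simp add: nn_integral_add nn_integral_multc)
    also have "\<dots> = ennreal (i * (a powr (1 - p) / p) + a * (1 - 1 / p) * w)"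
      using 4 p a by (simp flip: ennreal_mult ennreal_plus)
    also have "i * (a powr (1 - p) / p) + a * (1 - 1 / p) * w = a * w"
    proof -
      have "i * a powr (1 - p) = a * w"
        using a 4 by (simp add: powr_diff)
      then have "i * (a powr (1 - p) / p) = a * w / p"
        by simp
      then show ?thesis using p by (simp add: field_simps)
    qed
    finally have "ennreal_powr ?H p \<le> ennreal_powr (ennreal (a * w)) p"
      using p by (intro ennreal_powr_mono) auto
    also have "\<dots> = ennreal (w powr (p - 1) * i)"
      using a 4 by (simp add: ennreal_powr_ennreal powr_mult powr_diff)
    also have "\<dots> = ennreal_powr ?W (p - 1) * ?I"
      using 4 by (simp add: ennreal_powr_ennreal ennreal_mult)
    finally show ?thesis .
  qed
qed

subsection \<open>The multiplicative Haar measure\<close>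

definition mult_haar :: "real measure" where
  "mult_haar = density lborel (\<lambda>t. indicator {0<..} t * ennreal (1 / t))"

lemma sets_mult_haar [measurable_cong, simp]: "sets mult_haar = sets borel"
  by (simp add: mult_haar_def)

lemma space_mult_haar [simp]: "space mult_haar = UNIV"
  by (simp add: mult_haar_def)

lemma sigma_finite_mult_haar: "sigma_finite_measure mult_haar"
  unfolding mult_haar_def
  by (subst sigma_finite_measure.sigma_finite_iff_density_finite[OF lborel.sigma_finite_measure_axioms])
     (auto simp: indicator_def)

interpretation mult_haar: sigma_finite_measure mult_haar
  by (rule sigma_finite_mult_haar)

interpretation mult_haar2: pair_sigma_finite mult_haar mult_haar ..

lemma nn_integral_mult_haar:
  assumes [measurable]: "f \<in> borel_measurable borel"
  shows "(\<integral>\<^sup>+t. f t \<partial>mult_haar) = (\<integral>\<^sup>+t. indicator {0<..} t * ennreal (1 / t) * f t \<partial>lborel)"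
  unfolding mult_haar_def by (rule nn_integral_density) auto

lemma AE_mult_haar: "(AE t in mult_haar. P t) \<longleftrightarrow> (AE t in lborel. 0 < t \<longrightarrow> P t)"
  unfolding mult_haar_def by (subst AE_density) (auto simp: indicator_def)

lemma AE_mult_haar_pos: "AE t in mult_haar. 0 < t"
  by (simp add: AE_mult_haar)

lemma nn_integral_mult_haar_dilate:
  assumes [measurable]: "f \<in> borel_measurable borel" and c: "0 < c"
  shows "(\<integral>\<^sup>+t. f (c * t) \<partial>mult_haar) = (\<integral>\<^sup>+t. f t \<partial>mult_haar)"
proof -
  have "(\<integral>\<^sup>+t. f t \<partial>mult_haar)
      = ennreal c * (\<integral>\<^sup>+t. indicator {0<..} (c * t) * ennreal (1 / (c * t)) * f (c * t) \<partial>lborel)"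
    using c by (subst nn_integral_mult_haar, simp, subst nn_integral_real_affine[where t = 0 and c = c]) auto
  also have "\<dots> = (\<integral>\<^sup>+t. ennreal c * (indicator {0<..} (c * t) * ennreal (1 / (c * t)) * f (c * t)) \<partial>lborel)"
    by (simp add: nn_integral_cmult)
  also have "\<dots> = (\<integral>\<^sup>+t. indicator {0<..} t * ennreal (1 / t) * f (c * t) \<partial>lborel)"
  proof (intro nn_integral_cong)
    fix t :: real
    show "ennreal c * (indicator {0<..} (c * t) * ennreal (1 / (c * t)) * f (c * t))
        = indicator {0<..} t * ennreal (1 / t) * f (c * t)"
    proof (cases "0 < t")
      case True
      then have "ennreal c * ennreal (1 / (c * t)) = ennreal (1 / t)"
        using c by (simp flip: ennreal_mult)
      then show ?thesis
        using True c by (simp add: mult.assoc[symmetric])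
    qed (use c in \<open>auto simp: indicator_def zero_less_mult_iff\<close>)
  qed
  also have "\<dots> = (\<integral>\<^sup>+t. f (c * t) \<partial>mult_haar)"
    by (simp add: nn_integral_mult_haar)
  finally show ?thesis ..
qed

text \<open>
  Inversion invariance follows from dilation invariance as in the proof that Haar measure is
  unique: integrate \<open>f (v / s) * u s\<close> in both orders, for an auxiliary \<open>u\<close> of integral \<open>1\<close>.
\<close>
lemma nn_integral_mult_haar_inverse:
  assumes [measurable]: "f \<in> borel_measurable borel"
  shows "(\<integral>\<^sup>+t. f (1 / t) \<partial>mult_haar) = (\<integral>\<^sup>+t. f t \<partial>mult_haar)"
proof -
  define u :: "real \<Rightarrow> ennreal" where "u t = ennreal t * indicator {1..2} t" for t
  have [measurable]: "u \<in> borel_measurable borel"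
    unfolding u_def[abs_def] by measurable
  have u: "(\<integral>\<^sup>+t. u t \<partial>mult_haar) = 1"
  proof -
    have "(\<integral>\<^sup>+t. u t \<partial>mult_haar) = (\<integral>\<^sup>+t. indicator {1..2} (t :: real) \<partial>lborel)"
      unfolding nn_integral_mult_haar[OF \<open>u \<in> _\<close>]
      by (intro nn_integral_cong) (auto simp: u_def indicator_def simp flip: ennreal_mult)
    then show ?thesis by simp
  qed
  have "(\<integral>\<^sup>+t. f (1 / t) \<partial>mult_haar) = (\<integral>\<^sup>+s. f (1 / s) * (\<integral>\<^sup>+v. u v \<partial>mult_haar) \<partial>mult_haar)"
    by (simp add: u)
  also have "\<dots> = (\<integral>\<^sup>+s. (\<integral>\<^sup>+v. f (1 / s) * u (s * v) \<partial>mult_haar) \<partial>mult_haar)"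
    by (rule nn_integral_cong_AE, rule AE_mp[OF AE_mult_haar_pos], rule AE_I2)
       (simp add: nn_integral_cmult nn_integral_mult_haar_dilate)
  also have "\<dots> = (\<integral>\<^sup>+v. (\<integral>\<^sup>+s. f (1 / s) * u (s * v) \<partial>mult_haar) \<partial>mult_haar)"
    by (intro mult_haar2.Fubini') measurable
  also have "\<dots> = (\<integral>\<^sup>+v. (\<integral>\<^sup>+s. f (v / s) * u s \<partial>mult_haar) \<partial>mult_haar)"
  proof (rule nn_integral_cong_AE, rule AE_mp[OF AE_mult_haar_pos], rule AE_I2, rule impI)
    fix v :: real assume "0 < v"
    then show "(\<integral>\<^sup>+s. f (1 / s) * u (s * v) \<partial>mult_haar) = (\<integral>\<^sup>+s. f (v / s) * u s \<partial>mult_haar)"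
      by (subst nn_integral_mult_haar_dilate[symmetric, of "\<lambda>s. f (v / s) * u s" v]) (auto simp: mult.commute)
  qed
  also have "\<dots> = (\<integral>\<^sup>+s. (\<integral>\<^sup>+v. f (v / s) * u s \<partial>mult_haar) \<partial>mult_haar)"
    by (intro mult_haar2.Fubini') measurable
  also have "\<dots> = (\<integral>\<^sup>+s. (\<integral>\<^sup>+v. f v \<partial>mult_haar) * u s \<partial>mult_haar)"
  proof (rule nn_integral_cong_AE, rule AE_mp[OF AE_mult_haar_pos], rule AE_I2, rule impI)
    fix s :: real assume "0 < s"
    then show "(\<integral>\<^sup>+v. f (v / s) * u s \<partial>mult_haar) = (\<integral>\<^sup>+v. f v \<partial>mult_haar) * u s"
      using nn_integral_mult_haar_dilate[of f "1 / s"] by (simp add: nn_integral_multc)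
  qed
  also have "\<dots> = (\<integral>\<^sup>+v. f v \<partial>mult_haar)"
    by (simp add: nn_integral_cmult u)
  finally show ?thesis .
qed

lemma nn_integral_mult_haar_reflect:
  assumes [measurable]: "f \<in> borel_measurable borel" and r: "0 < r"
  shows "(\<integral>\<^sup>+t. f (r / t) \<partial>mult_haar) = (\<integral>\<^sup>+t. f t \<partial>mult_haar)"
  using nn_integral_mult_haar_inverse[of "\<lambda>t. f (r * t)"] nn_integral_mult_haar_dilate[of f r] r
  by simp

lemma nn_integral_mult_conv_powr_le:
  assumes [measurable]: "w \<in> borel_measurable borel" "F \<in> borel_measurable borel"
    and p: "1 \<le> p" and fin: "(\<integral>\<^sup>+t. w t \<partial>mult_haar) \<noteq> top"
  shows "(\<integral>\<^sup>+r. ennreal_powr (\<integral>\<^sup>+s. w (r / s) * F s \<partial>mult_haar) p \<partial>mult_haar)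
    \<le> ennreal_powr (\<integral>\<^sup>+t. w t \<partial>mult_haar) p * (\<integral>\<^sup>+s. ennreal_powr (F s) p \<partial>mult_haar)"
    (is "?L \<le> ennreal_powr ?C p * ?N")
proof -
  have C: "ennreal_powr ?C (p - 1) * ?C = ennreal_powr ?C p"
    using fin by (cases ?C) (auto simp: ennreal_powr_ennreal powr_diff field_simps simp flip: ennreal_mult)
  have "?L \<le> (\<integral>\<^sup>+r. ennreal_powr ?C (p - 1)
      * (\<integral>\<^sup>+s. w (r / s) * ennreal_powr (F s) p \<partial>mult_haar) \<partial>mult_haar)"
  proof (rule nn_integral_mono_AE, rule AE_mp[OF AE_mult_haar_pos], rule AE_I2, rule impI)
    fix r :: real assume r: "0 < r"
    define M where "M = density mult_haar (\<lambda>s. w (r / s))"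
    have [measurable_cong]: "sets M = sets borel"
      by (simp add: M_def)
    have M: "(\<integral>\<^sup>+s. h s \<partial>M) = (\<integral>\<^sup>+s. w (r / s) * h s \<partial>mult_haar)"
      if [measurable]: "h \<in> borel_measurable borel" for h
      unfolding M_def by (rule nn_integral_density) auto
    have "emeasure M (space M) = ?C"
      using M[of "\<lambda>_. 1"] nn_integral_mult_haar_reflect[of w r] r by simp
    then show "ennreal_powr (\<integral>\<^sup>+s. w (r / s) * F s \<partial>mult_haar) p
      \<le> ennreal_powr ?C (p - 1) * (\<integral>\<^sup>+s. w (r / s) * ennreal_powr (F s) p \<partial>mult_haar)"
      using nn_integral_powr_le[of F M p] p fin by (simp add: M)
  qed
  also have "\<dots> = ennreal_powr ?C (p - 1)
      * (\<integral>\<^sup>+r. (\<integral>\<^sup>+s. w (r / s) * ennreal_powr (F s) p \<partial>mult_haar) \<partial>mult_haar)"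
    by (intro nn_integral_cmult) measurable
  also have "(\<integral>\<^sup>+r. (\<integral>\<^sup>+s. w (r / s) * ennreal_powr (F s) p \<partial>mult_haar) \<partial>mult_haar)
      = (\<integral>\<^sup>+s. (\<integral>\<^sup>+r. w (r / s) * ennreal_powr (F s) p \<partial>mult_haar) \<partial>mult_haar)"
    by (intro mult_haar2.Fubini') measurable
  also have "\<dots> = (\<integral>\<^sup>+s. ?C * ennreal_powr (F s) p \<partial>mult_haar)"
  proof (rule nn_integral_cong_AE, rule AE_mp[OF AE_mult_haar_pos], rule AE_I2, rule impI)
    fix s :: real assume "0 < s"
    then show "(\<integral>\<^sup>+r. w (r / s) * ennreal_powr (F s) p \<partial>mult_haar) = ?C * ennreal_powr (F s) p"
      using nn_integral_mult_haar_dilate[of w "1 / s"] by (simp add: nn_integral_multc)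
  qed
  also have "\<dots> = ?C * ?N"
    by (intro nn_integral_cmult) measurable
  finally show ?thesis
    by (simp add: mult.assoc[symmetric] C)
qed

subsection \<open>Polar coordinates\<close>

lemma sets_sphere_measure [simp]:
  "sets (sphere_measure :: 'a::euclidean_space measure) = sets (restrict_space borel (sphere 0 1))"
  by (simp add: sphere_measure_def)

declare space_sphere_measure [simp]

lemma in_sets_sphere_measure:
  "A \<in> sets (sphere_measure :: 'a::euclidean_space measure) \<longleftrightarrow> A \<in> sets borel \<and> A \<subseteq> sphere 0 1"
  by (auto simp: sets_restrict_space_iff)

lemma finite_measure_sphere_measure: "finite_measure (sphere_measure :: 'a::euclidean_space measure)"
  by (rule finite_measureI) (simp add: emeasure_sphere_measure_UNIV)

interpretation sphere_measure: finite_measure "sphere_measure :: 'a::euclidean_space measure"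
  by (rule finite_measure_sphere_measure)

interpretation haar_sphere: pair_sigma_finite mult_haar "sphere_measure :: 'a::euclidean_space measure" ..

lemma measurable_sphere_measure:
  "f \<in> borel \<rightarrow>\<^sub>M N \<Longrightarrow> f \<in> (sphere_measure :: 'a::euclidean_space measure) \<rightarrow>\<^sub>M N"
  by (subst measurable_cong_sets[OF sets_sphere_measure refl]) (rule measurable_restrict_space1)

lemma measurable_scaleR_sphere [measurable (raw)]:
  fixes h :: "'a::euclidean_space \<Rightarrow> 'b"
  assumes "h \<in> borel \<rightarrow>\<^sub>M N"
  shows "(\<lambda>z. h (fst z *\<^sub>R snd z)) \<in> borel \<Otimes>\<^sub>M sphere_measure \<rightarrow>\<^sub>M N"
proof -
  have "(\<lambda>\<theta>. \<theta>) \<in> (sphere_measure :: 'a measure) \<rightarrow>\<^sub>M borel"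
    by (rule measurable_sphere_measure) simp
  then have "(\<lambda>z. fst z *\<^sub>R snd z) \<in> borel \<Otimes>\<^sub>M (sphere_measure :: 'a measure) \<rightarrow>\<^sub>M borel"
    by (intro borel_measurable_scaleR measurable_fst measurable_compose[OF measurable_snd])
  then show ?thesis
    using assms by (rule measurable_compose)
qed

lemma measurable_scaleR_sphere' [measurable (raw)]:
  fixes h :: "'a::euclidean_space \<Rightarrow> 'b"
  assumes "h \<in> borel \<rightarrow>\<^sub>M N"
  shows "(\<lambda>\<theta>. h (r *\<^sub>R \<theta>)) \<in> sphere_measure \<rightarrow>\<^sub>M N"
  by (rule measurable_sphere_measure, rule measurable_compose[OF _ assms]) simp

lemma borel_measurable_nn_integral_sphere [measurable (raw)]:
  fixes h :: "'a::euclidean_space \<Rightarrow> ennreal"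
  assumes "h \<in> borel_measurable borel"
  shows "(\<lambda>r. \<integral>\<^sup>+\<theta>. h (r *\<^sub>R \<theta>) \<partial>sphere_measure) \<in> borel_measurable borel"
  using measurable_scaleR_sphere[OF assms]
  by (intro sphere_measure.borel_measurable_nn_integral) (simp add: case_prod_beta')

lemma measurable_sgn_borel [measurable]: "(sgn :: 'a::euclidean_space \<Rightarrow> 'a) \<in> borel \<rightarrow>\<^sub>M borel"
  unfolding sgn_div_norm[abs_def] by measurable

definition radial_weight :: "nat \<Rightarrow> real measure" where
  "radial_weight n = density mult_haar (\<lambda>r. ennreal (r ^ n))"

lemma sets_radial_weight [measurable_cong, simp]: "sets (radial_weight n) = sets borel"
  by (simp add: radial_weight_def)

lemma sigma_finite_radial_weight: "sigma_finite_measure (radial_weight n)"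
  unfolding radial_weight_def
  by (subst mult_haar.sigma_finite_iff_density_finite) simp_all

lemma nn_integral_radial_weight:
  assumes [measurable]: "f \<in> borel_measurable borel"
  shows "(\<integral>\<^sup>+r. f r \<partial>radial_weight n) = (\<integral>\<^sup>+r. ennreal (r ^ n) * f r \<partial>mult_haar)"
  unfolding radial_weight_def by (rule nn_integral_density) measurable

lemma emeasure_radial_weight_lessThan:
  assumes n: "0 < n"
  shows "emeasure (radial_weight n) {..<b} = ennreal (max b 0 ^ n / n)"
proof (cases "0 < b")
  case True
  have "emeasure (radial_weight n) {..<b} = (\<integral>\<^sup>+r. indicator {..<b} r \<partial>radial_weight n)"
    by (rule nn_integral_indicator[symmetric]) simp
  also have "\<dots> = (\<integral>\<^sup>+r. ennreal (r ^ n) * indicator {..<b} r \<partial>mult_haar)"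
    by (rule nn_integral_radial_weight) simp
  also have "\<dots> = (\<integral>\<^sup>+r. indicator {0<..} r * ennreal (1 / r) * (ennreal (r ^ n) * indicator {..<b} r) \<partial>lborel)"
    by (rule nn_integral_mult_haar) measurable
  also have "\<dots> = (\<integral>\<^sup>+r. ennreal (r ^ (n - 1)) * indicator {0..b} r \<partial>lborel)"
  proof (rule nn_integral_cong_AE)
    have "AE r in lborel. r \<noteq> 0 \<and> r \<noteq> b"
      using AE_lborel_singleton[of 0] AE_lborel_singleton[of b] by (rule AE_conjI)
    then show "AE r in lborel. indicator {0<..} r * ennreal (1 / r) * (ennreal (r ^ n) * indicator {..<b} r)
        = ennreal (r ^ (n - 1)) * indicator {0..b} r"
    proof (rule AE_mp, intro AE_I2 impI)
      fix r :: real assume r: "r \<noteq> 0 \<and> r \<noteq> b"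
      show "indicator {0<..} r * ennreal (1 / r) * (ennreal (r ^ n) * indicator {..<b} r)
        = ennreal (r ^ (n - 1)) * indicator {0..b} r"
      proof (cases "0 < r")
        case True
        with n have "ennreal (1 / r) * ennreal (r ^ n) = ennreal (r ^ (n - 1))"
          by (simp add: power_diff flip: ennreal_mult)
        with True r show ?thesis
          by (auto simp: indicator_def)
      qed (use r in \<open>auto simp: indicator_def\<close>)
    qed
  qed
  also have "\<dots> = ennreal (b ^ n / n - 0 ^ n / n)"
  proof (rule nn_integral_FTC_Icc)
    show "((\<lambda>x. x ^ n / real n) has_real_derivative x ^ (n - 1)) (at x)" for x
      using n by (auto intro!: derivative_eq_intros)
  qed (use True in auto)
  finally show ?thesis
    using True n by (simp add: max_def zero_power)
next
  case False
  have "emeasure (radial_weight n) {..<b} = (\<integral>\<^sup>+r. indicator {..<b} r \<partial>radial_weight n)"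
    by (rule nn_integral_indicator[symmetric]) simp
  also have "\<dots> = (\<integral>\<^sup>+r. ennreal (r ^ n) * indicator {..<b} r \<partial>mult_haar)"
    by (rule nn_integral_radial_weight) simp
  also have "\<dots> = (\<integral>\<^sup>+r. 0 \<partial>mult_haar)"
    by (rule nn_integral_cong_AE, rule AE_mp[OF AE_mult_haar_pos], rule AE_I2)
       (use False in \<open>auto simp: indicator_def\<close>)
  finally show ?thesis using False n by (simp add: max_def)
qed

lemma emeasure_lborel_cone:
  fixes B :: "'a::euclidean_space set"
  assumes B: "B \<in> sets borel" "B \<subseteq> sphere 0 1"
  shows "emeasure lborel {x. x \<noteq> 0 \<and> sgn x \<in> B \<and> norm x < b}
    = ennreal (max b 0 ^ DIM('a) / DIM('a)) * emeasure sphere_measure B"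
proof (cases "0 < b")
  case True
  let ?S = "{x \<in> ball 0 1 - {0}. sgn x \<in> B}"
  have [measurable]: "B \<in> sets borel" by fact
  have S: "?S \<in> sets borel" by measurable
  have "{x. x \<noteq> 0 \<and> sgn x \<in> B \<and> norm x < b} = (\<lambda>x. b *\<^sub>R x + 0) ` ?S" (is "?T = _")
  proof (intro equalityI subsetI)
    fix x assume "x \<in> ?T"
    then show "x \<in> (\<lambda>x. b *\<^sub>R x + 0) ` ?S"
      using True by (intro image_eqI[of _ _ "x /\<^sub>R b"]) (auto simp: sgn_scaleR field_simps)
  qed (use True in \<open>auto simp: sgn_scaleR\<close>)
  moreover have "emeasure lebesgue ((\<lambda>x. b *\<^sub>R x + 0) ` ?S) = \<bar>b\<bar> ^ DIM('a) * emeasure lebesgue ?S"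
    by (rule emeasure_lebesgue_affine)
  moreover have "?T \<in> sets borel" by measurable
  ultimately have "emeasure lborel ?T = ennreal (b ^ DIM('a)) * emeasure lborel ?S"
    using True S by simp
  also have "emeasure lborel ?S = ennreal (1 / DIM('a)) * emeasure sphere_measure B"
    unfolding emeasure_sphere_measure[OF B]
    by (simp add: mult.assoc[symmetric] ennreal_of_nat_eq_real_of_nat flip: ennreal_mult)
  finally show ?thesis
    using True by (simp add: mult.assoc[symmetric] max_def flip: ennreal_mult)
next
  case False
  then have "{x. x \<noteq> 0 \<and> sgn x \<in> B \<and> norm x < b} = {}"
    by (auto simp: not_less intro: order_trans[OF _ norm_ge_zero])
  then have "emeasure lborel {x. x \<noteq> 0 \<and> sgn x \<in> B \<and> norm x < b} = 0"
    by (simp only: emeasure_empty)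
  then show ?thesis using False by (simp add: max_def power_0_left)
qed

lemma radial_weight_cone:
  fixes B :: "'a::euclidean_space set"
  assumes B: "B \<in> sets borel" "B \<subseteq> sphere 0 1"
  shows "scale_measure (emeasure sphere_measure B) (radial_weight DIM('a))
    = distr (restrict_space lborel {x. x \<noteq> 0 \<and> sgn x \<in> B}) borel norm" (is "?M = ?N")
proof (rule measure_eqI_generator_eq[where E = "range lessThan" and \<Omega> = UNIV and A = "\<lambda>i. {..<real i}"])
  have [measurable]: "B \<in> sets borel" by fact
  have *: "sets borel = sigma_sets UNIV (range (lessThan :: real \<Rightarrow> _))"
    using arg_cong[OF borel_eq_lessThan[where 'a = real], of sets]
    by (simp add: lessThan_def[abs_def] eucl_less_def)
  show "sets ?M = sigma_sets UNIV (range lessThan)" "sets ?N = sigma_sets UNIV (range lessThan)"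
    by (simp_all only: sets_scale_measure sets_radial_weight sets_distr *)
  show "Int_stable (range (lessThan :: real \<Rightarrow> _))"
  proof (rule Int_stableI, elim rangeE)
    fix X Y :: "real set" and a b assume "X = {..<a}" "Y = {..<b}"
    then have "X \<inter> Y = {..<min a b}" by auto
    then show "X \<inter> Y \<in> range lessThan" by simp
  qed
  show "(\<Union>i. {..<real i}) = UNIV"
    by (auto intro: reals_Archimedean2)
  show "emeasure ?M {..<real i} \<noteq> \<infinity>" for i
    by (simp add: emeasure_radial_weight_lessThan ennreal_mult_eq_top_iff)
  fix X :: "real set" assume "X \<in> range lessThan"
  then obtain b where X: "X = {..<b}" by auto
  let ?C = "{x. x \<noteq> 0 \<and> sgn x \<in> B}"
  have C: "?C \<in> sets borel" by measurable
  have "emeasure ?N X = emeasure (restrict_space lborel ?C) (norm -` X \<inter> ?C)"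
    using X by (subst emeasure_distr) (auto simp: space_restrict_space intro!: measurable_restrict_space1)
  also have "\<dots> = emeasure lborel (norm -` X \<inter> ?C)"
    using C by (intro emeasure_restrict_space) auto
  also have "norm -` X \<inter> ?C = {x. x \<noteq> 0 \<and> sgn x \<in> B \<and> norm x < b}"
    by (auto simp: X)
  finally show "emeasure ?M X = emeasure ?N X"
    by (simp add: X emeasure_lborel_cone[OF B] emeasure_radial_weight_lessThan mult.commute)
qed auto

lemma measurable_polar [measurable]:
  "(\<lambda>x. (norm x, sgn x)) \<in> restrict_space lborel (- {0})
     \<rightarrow>\<^sub>M borel \<Otimes>\<^sub>M (sphere_measure :: 'a::euclidean_space measure)"
proof (rule measurable_Pair)
  have "sgn \<in> restrict_space lborel (- {0::'a}) \<rightarrow>\<^sub>M restrict_space borel (sphere 0 1)"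
    by (intro measurable_restrict_space2 measurable_restrict_space1)
       (auto simp: space_restrict_space norm_sgn)
  then show "sgn \<in> restrict_space lborel (- {0::'a}) \<rightarrow>\<^sub>M sphere_measure"
    by (simp add: measurable_cong_sets[OF refl sets_sphere_measure])
qed (intro measurable_restrict_space1, simp)

lemma distr_polar:
  "radial_weight DIM('a) \<Otimes>\<^sub>M sphere_measure
    = distr (restrict_space lborel (- {0})) (borel \<Otimes>\<^sub>M (sphere_measure :: 'a::euclidean_space measure))
        (\<lambda>x. (norm x, sgn x))" (is "_ = ?D")
proof (rule pair_measure_eqI[OF sigma_finite_radial_weight sphere_measure.sigma_finite_measure_axioms])
  show "sets (radial_weight DIM('a) \<Otimes>\<^sub>M sphere_measure) = sets ?D"
    by (simp cong: sets_pair_measure_cong del: sets_sphere_measure)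
  fix A and B :: "'a set"
  assume "A \<in> sets (radial_weight DIM('a))" and "B \<in> sets sphere_measure"
  then have A [measurable]: "A \<in> sets borel" and B [measurable]: "B \<in> sets borel" and B': "B \<subseteq> sphere 0 1"
    and B'': "B \<in> sets sphere_measure"
    by (auto simp: in_sets_sphere_measure simp del: sets_sphere_measure)
  let ?C = "{x. x \<noteq> 0 \<and> sgn x \<in> B}"
  have C: "?C \<in> sets borel" by measurable
  have "emeasure (radial_weight DIM('a)) A * emeasure sphere_measure B
      = emeasure (distr (restrict_space lborel ?C) borel norm) A"
    by (subst radial_weight_cone[OF B B', symmetric]) (simp add: mult.commute)
  also have "\<dots> = emeasure (restrict_space lborel ?C) (norm -` A \<inter> ?C)"
    by (subst emeasure_distr) (auto simp: space_restrict_space intro!: measurable_restrict_space1)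
  also have "\<dots> = emeasure lborel (norm -` A \<inter> ?C)"
    using C by (intro emeasure_restrict_space) auto
  also have "norm -` A \<inter> ?C = (\<lambda>x. (norm x, sgn x)) -` (A \<times> B) \<inter> (- {0})"
    by auto
  also have "emeasure lborel \<dots> = emeasure (restrict_space lborel (- {0})) ((\<lambda>x. (norm x, sgn x)) -` (A \<times> B) \<inter> (- {0}))"
    by (intro emeasure_restrict_space[symmetric]) auto
  also have "\<dots> = emeasure ?D (A \<times> B)"
    using A B'' by (subst emeasure_distr[OF measurable_polar]) (auto simp: space_restrict_space simp del: sets_sphere_measure)
  finally show "emeasure (radial_weight DIM('a)) A * emeasure sphere_measure B = emeasure ?D (A \<times> B)" .
qed

lemma nn_integral_polar:
  fixes h :: "'a::euclidean_space \<Rightarrow> ennreal"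
  assumes [measurable]: "h \<in> borel_measurable borel"
  shows "(\<integral>\<^sup>+x. h x \<partial>lborel)
    = (\<integral>\<^sup>+r. ennreal (r ^ DIM('a)) * (\<integral>\<^sup>+\<theta>. h (r *\<^sub>R \<theta>) \<partial>sphere_measure) \<partial>mult_haar)"
proof -
  have [measurable]: "(\<lambda>(r, \<theta>). h (r *\<^sub>R \<theta>)) \<in> borel_measurable (borel \<Otimes>\<^sub>M sphere_measure)"
    using measurable_scaleR_sphere[OF assms] by (simp add: case_prod_beta')
  have "(\<integral>\<^sup>+x. h x \<partial>lborel) = (\<integral>\<^sup>+x. h x * indicator (- {0}) x \<partial>lborel)"
    by (rule nn_integral_cong_AE, rule AE_mp[OF AE_lborel_singleton[of 0]], rule AE_I2) auto
  also have "\<dots> = (\<integral>\<^sup>+x. h x \<partial>restrict_space lborel (- {0}))"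
    by (simp add: nn_integral_restrict_space)
  also have "\<dots> = (\<integral>\<^sup>+x. (case (norm x, sgn x) of (r, \<theta>) \<Rightarrow> h (r *\<^sub>R \<theta>)) \<partial>restrict_space lborel (- {0}))"
    by (intro nn_integral_cong) (simp add: sgn_div_norm)
  also have "\<dots> = (\<integral>\<^sup>+z. (case z of (r, \<theta>) \<Rightarrow> h (r *\<^sub>R \<theta>))
      \<partial>(radial_weight DIM('a) \<Otimes>\<^sub>M (sphere_measure :: 'a measure)))"
    unfolding distr_polar by (intro nn_integral_distr[symmetric]) measurable
  also have "\<dots> = (\<integral>\<^sup>+r. (\<integral>\<^sup>+\<theta>. h (r *\<^sub>R \<theta>) \<partial>sphere_measure) \<partial>radial_weight DIM('a))"
    by (subst sphere_measure.nn_integral_fst[symmetric]) auto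
  also have "\<dots> = (\<integral>\<^sup>+r. ennreal (r ^ DIM('a)) * (\<integral>\<^sup>+\<theta>. h (r *\<^sub>R \<theta>) \<partial>sphere_measure) \<partial>mult_haar)"
    by (intro nn_integral_radial_weight) measurable
  finally show ?thesis .
qed

lemma AE_polar:
  fixes P :: "'a::euclidean_space \<Rightarrow> bool"
  assumes "AE x in lborel. P x"
  shows "AE r in mult_haar. AE \<theta> in sphere_measure. P (r *\<^sub>R \<theta>)"
    and "AE \<theta> in sphere_measure. AE r in mult_haar. P (r *\<^sub>R \<theta>)"
proof -
  obtain N where N: "{x \<in> space lborel. \<not> P x} \<subseteq> N" "emeasure lborel N = 0" "N \<in> sets lborel"
    using assms by (rule AE_E)
  then have [measurable]: "N \<in> sets borel" by simp
  have P: "P x" if "x \<notin> N" for x using N that by auto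
  have "(\<integral>\<^sup>+r. ennreal (r ^ DIM('a)) * (\<integral>\<^sup>+\<theta>. indicator N (r *\<^sub>R \<theta>) \<partial>(sphere_measure :: 'a measure)) \<partial>mult_haar) = 0"
    using N by (subst nn_integral_polar[symmetric]) auto
  then have 0: "AE r in mult_haar. ennreal (r ^ DIM('a)) * (\<integral>\<^sup>+\<theta>. indicator N (r *\<^sub>R \<theta>) \<partial>(sphere_measure :: 'a measure)) = 0"
  proof (rule nn_integral_0_iff_AE[THEN iffD1, rotated])
    have [measurable]: "(\<lambda>r. \<integral>\<^sup>+\<theta>. indicator N (r *\<^sub>R \<theta>) \<partial>(sphere_measure :: 'a measure)) \<in> borel_measurable borel"
      by (rule borel_measurable_nn_integral_sphere) simp
    show "(\<lambda>r. ennreal (r ^ DIM('a)) * (\<integral>\<^sup>+\<theta>. indicator N (r *\<^sub>R \<theta>) \<partial>(sphere_measure :: 'a measure))) \<in> borel_measurable mult_haar"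
      by measurable
  qed
  have ae: "AE r in mult_haar. AE \<theta> in (sphere_measure :: 'a measure). r *\<^sub>R \<theta> \<notin> N"
    using AE_mult_haar_pos 0
  proof eventually_elim
    case (elim r)
    then have "(\<integral>\<^sup>+\<theta>. indicator N (r *\<^sub>R \<theta>) \<partial>(sphere_measure :: 'a measure)) = 0"
      by simp
    then show ?case
      by (subst (asm) nn_integral_0_iff_AE) (auto simp: indicator_eq_0_iff)
  qed
  show "AE r in mult_haar. AE \<theta> in sphere_measure. P (r *\<^sub>R \<theta>)"
    by (rule eventually_mono[OF ae], erule eventually_mono, rule P)
  from ae have "AE \<theta> in (sphere_measure :: 'a measure). AE r in mult_haar. r *\<^sub>R \<theta> \<notin> N"
  proof (subst (asm) haar_sphere.AE_commute)
    have "Measurable.pred (borel \<Otimes>\<^sub>M (sphere_measure :: 'a measure)) (\<lambda>z. fst z *\<^sub>R snd z \<notin> N)"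
      by (rule measurable_scaleR_sphere) measurable
    then have "Measurable.pred (mult_haar \<Otimes>\<^sub>M (sphere_measure :: 'a measure)) (\<lambda>z. fst z *\<^sub>R snd z \<notin> N)"
      by (simp only: measurable_cong_sets[OF sets_pair_measure_cong[OF sets_mult_haar refl] refl])
    then show "{z \<in> space (mult_haar \<Otimes>\<^sub>M (sphere_measure :: 'a measure)). fst z *\<^sub>R snd z \<notin> N}
        \<in> sets (mult_haar \<Otimes>\<^sub>M sphere_measure)"
      by (simp only: pred_def)
  qed
  then show "AE \<theta> in sphere_measure. AE r in mult_haar. P (r *\<^sub>R \<theta>)"
    by (rule eventually_mono, elim eventually_mono) (rule P)
qed

lemma AE_mult_haar_reflect:
  assumes "AE t in mult_haar. P t" and c: "0 < c"
  shows "AE t in mult_haar. P (c / t)"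
proof -
  obtain N where N: "{x \<in> space mult_haar. \<not> P x} \<subseteq> N" "emeasure mult_haar N = 0" "N \<in> sets mult_haar"
    using assms(1) by (rule AE_E)
  then have [measurable]: "N \<in> sets borel" by simp
  have "(\<integral>\<^sup>+t. indicator N (c / t) \<partial>mult_haar) = 0"
    using N c by (simp add: nn_integral_mult_haar_reflect)
  then have "AE t in mult_haar. c / t \<notin> N"
    by (subst (asm) nn_integral_0_iff_AE) (auto simp: indicator_eq_0_iff)
  then show ?thesis
    by (rule eventually_mono) (use N in auto)
qed

lemma AE_norm:
  assumes "AE t in mult_haar. P t"
  shows "AE x in (lborel :: 'a::euclidean_space measure). P (norm x)"
proof -
  obtain N where N: "{x \<in> space mult_haar. \<not> P x} \<subseteq> N" "emeasure mult_haar N = 0" "N \<in> sets mult_haar"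
    using assms by (rule AE_E)
  then have [measurable]: "N \<in> sets borel" by simp
  have "(\<integral>\<^sup>+x. indicator N (norm (x :: 'a)) \<partial>lborel)
      = (\<integral>\<^sup>+r. ennreal (r ^ DIM('a)) * (\<integral>\<^sup>+\<theta>. indicator N (norm (r *\<^sub>R \<theta>)) \<partial>(sphere_measure :: 'a measure)) \<partial>mult_haar)"
    by (rule nn_integral_polar) auto
  also have "\<dots> = (\<integral>\<^sup>+r. 0 \<partial>mult_haar)"
  proof (rule nn_integral_cong_AE)
    have "AE r in mult_haar. 0 < r \<and> r \<notin> N"
      by (intro AE_conjI AE_mult_haar_pos AE_not_in null_setsI) (use N in auto)
    then show "AE r in mult_haar. ennreal (r ^ DIM('a)) * (\<integral>\<^sup>+\<theta>. indicator N (norm (r *\<^sub>R \<theta>)) \<partial>(sphere_measure :: 'a measure)) = 0"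
    proof (rule AE_mp, intro AE_I2 impI)
      fix r :: real assume r: "0 < r \<and> r \<notin> N"
      have "(\<integral>\<^sup>+\<theta>. indicator N (norm (r *\<^sub>R \<theta>)) \<partial>(sphere_measure :: 'a measure))
          = (\<integral>\<^sup>+\<theta>. 0 \<partial>(sphere_measure :: 'a measure))"
        using r by (intro nn_integral_cong) auto
      then show "ennreal (r ^ DIM('a)) * (\<integral>\<^sup>+\<theta>. indicator N (norm (r *\<^sub>R \<theta>)) \<partial>(sphere_measure :: 'a measure)) = 0"
        by simp
    qed
  qed
  finally have "(\<integral>\<^sup>+x. indicator N (norm (x :: 'a)) \<partial>lborel) = 0"
    by simp
  then have "AE x in (lborel :: 'a measure). norm x \<notin> N"
    by (subst (asm) nn_integral_0_iff_AE) (auto simp: indicator_eq_0_iff)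
  then show ?thesis
    by (rule eventually_mono) (use N in auto)
qed

subsection \<open>Borel representatives and mixed norms\<close>

lemma lebesgue_measurable_ex_borel:
  fixes f :: "'a::euclidean_space \<Rightarrow> complex"
  assumes "f \<in> borel_measurable lebesgue"
  shows "\<exists>g\<in>borel_measurable borel. AE x in lborel. f x = g x"
proof -
  have "(\<lambda>x. Re (f x)) \<in> borel_measurable lebesgue" "(\<lambda>x. Im (f x)) \<in> borel_measurable lebesgue"
    using assms by (auto intro: measurable_compose)
  from this[THEN completion_ex_borel_measurable_real]
  obtain u v where [measurable]: "u \<in> borel_measurable lborel" "v \<in> borel_measurable lborel"
    and u: "AE x in lborel. Re (f x) = u x" and v: "AE x in lborel. Im (f x) = v x"
    by blast
  from u v have "AE x in lborel. f x = complex_of_real (u x) + \<i> * complex_of_real (v x)"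
    by eventually_elim (simp add: complex_eq_iff)
  moreover have "(\<lambda>x. complex_of_real (u x) + \<i> * complex_of_real (v x)) \<in> borel_measurable borel"
    by measurable
  ultimately show ?thesis by (rule bexI)
qed

lemma radial_value_norm: "radial \<Phi> \<Longrightarrow> radial_value \<Phi> (norm x) = \<Phi> x"
  unfolding radial_value_def radial_def by (metis (mono_tags, lifting) someI_ex)

lemma AE_sphere_measure_ex:
  assumes "AE \<theta> in (sphere_measure :: 'a::euclidean_space measure). P \<theta>"
  shows "\<exists>\<theta>\<in>sphere 0 1. P \<theta>"
proof (rule ccontr)
  assume *: "\<not> ?thesis"
  from assms AE_space have "AE \<theta> in (sphere_measure :: 'a measure). False"
    by eventually_elim (use * in auto)
  then have "emeasure (sphere_measure :: 'a measure) (sphere 0 1) = 0"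
    using ae_filter_eq_bot_iff[of "sphere_measure :: 'a measure"] by (simp add: eventually_False)
  moreover have "0 < DIM('a) * unit_ball_vol DIM('a)"
    by (simp add: unit_ball_vol_pos)
  ultimately show False
    by (simp add: emeasure_sphere_measure_UNIV)
qed

lemma radial_value_ex_borel:
  fixes \<Phi> :: "'a::euclidean_space \<Rightarrow> complex"
  assumes "\<Phi> \<in> borel_measurable lebesgue" and "radial \<Phi>"
  shows "\<exists>\<psi>\<in>borel_measurable borel. AE t in mult_haar. radial_value \<Phi> t = \<psi> t"
proof -
  obtain g where [measurable]: "g \<in> borel_measurable borel" and "AE x in lborel. \<Phi> x = g x"
    using lebesgue_measurable_ex_borel[OF assms(1)] by blast
  then obtain \<theta> :: 'a where \<theta>: "norm \<theta> = 1" "AE r in mult_haar. \<Phi> (r *\<^sub>R \<theta>) = g (r *\<^sub>R \<theta>)"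
    using AE_sphere_measure_ex[OF AE_polar(2)] by force
  from \<theta>(2) AE_mult_haar_pos have "AE r in mult_haar. radial_value \<Phi> r = g (r *\<^sub>R \<theta>)"
  proof eventually_elim
    case (elim r)
    then show ?case
      using radial_value_norm[OF assms(2), of "r *\<^sub>R \<theta>"] \<theta>(1) by simp
  qed
  moreover have "(\<lambda>r. g (r *\<^sub>R \<theta>)) \<in> borel_measurable borel"
    by measurable
  ultimately show ?thesis by (rule bexI)
qed

lemma radial_integral_eq_mult_haar:
  assumes [measurable]: "X \<in> borel_measurable borel" and n: "0 < n"
  shows "(\<integral>\<^sup>+r\<in>{0<..}. X r * ennreal (r ^ (n - 1)) \<partial>lebesgue) = (\<integral>\<^sup>+r. X r * ennreal (r ^ n) \<partial>mult_haar)"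
proof -
  have "(\<integral>\<^sup>+r. X r * ennreal (r ^ n) \<partial>mult_haar)
      = (\<integral>\<^sup>+r. indicator {0<..} r * ennreal (1 / r) * (X r * ennreal (r ^ n)) \<partial>lborel)"
    by (rule nn_integral_mult_haar) measurable
  also have "\<dots> = (\<integral>\<^sup>+r\<in>{0<..}. X r * ennreal (r ^ (n - 1)) \<partial>lborel)"
  proof (rule nn_integral_cong)
    fix r :: real
    show "indicator {0<..} r * ennreal (1 / r) * (X r * ennreal (r ^ n))
        = X r * ennreal (r ^ (n - 1)) * indicator {0<..} r"
    proof (cases "0 < r")
      case True
      then have "ennreal (1 / r) * ennreal (r ^ n) = ennreal (r ^ (n - 1))"
        using n by (simp add: power_diff flip: ennreal_mult)
      then show ?thesis
        using True by (simp add: mult.left_commute)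
    qed simp
  qed
  finally show ?thesis
    by (simp add: nn_integral_completion)
qed

lemma hausdorff_const_eq:
  fixes \<Phi> :: "'a::euclidean_space \<Rightarrow> complex"
  assumes [measurable]: "\<psi> \<in> borel_measurable borel"
    and ae: "AE t in mult_haar. radial_value \<Phi> t = \<psi> t"
  shows "hausdorff_const \<Phi> p = (\<integral>\<^sup>+t. ennreal (cmod (\<psi> t) * t powr (DIM('a) / p)) \<partial>mult_haar)"
proof -
  have "(\<integral>\<^sup>+t. ennreal (cmod (\<psi> t) * t powr (DIM('a) / p)) \<partial>mult_haar)
      = (\<integral>\<^sup>+t. indicator {0<..} t * ennreal (1 / t) * ennreal (cmod (\<psi> t) * t powr (DIM('a) / p)) \<partial>lborel)"
    by (rule nn_integral_mult_haar) measurable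
  also have "\<dots> = (\<integral>\<^sup>+t\<in>{0<..}. ennreal (cmod (radial_value \<Phi> t) / t * t powr (DIM('a) / p)) \<partial>lborel)"
  proof (rule nn_integral_cong_AE)
    show "AE t in lborel. indicator {0<..} t * ennreal (1 / t) * ennreal (cmod (\<psi> t) * t powr (DIM('a) / p))
      = ennreal (cmod (radial_value \<Phi> t) / t * t powr (DIM('a) / p)) * indicator {0<..} t"
      using ae unfolding AE_mult_haar
      by eventually_elim (auto simp: indicator_def simp flip: ennreal_mult)
  qed
  finally show ?thesis
    by (simp add: hausdorff_const_def nn_integral_completion)
qed

lemma radang_norm_eq:
  fixes f g :: "'a::euclidean_space \<Rightarrow> complex"
  assumes [measurable]: "g \<in> borel_measurable borel" and ae: "AE x in lborel. f x = g x"
  shows "radang_norm p q f = ennreal_powr (\<integral>\<^sup>+r. ennreal_powr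
      (\<integral>\<^sup>+\<theta>. ennreal_powr (ennreal (cmod (g (r *\<^sub>R \<theta>)))) q \<partial>sphere_measure) (p / q) * ennreal (r ^ DIM('a)) \<partial>mult_haar) (1 / p)"
proof -
  let ?F = "\<lambda>r. \<integral>\<^sup>+\<theta>. ennreal_powr (ennreal (cmod (g (r *\<^sub>R \<theta>)))) q \<partial>(sphere_measure :: 'a measure)"
  have F: "?F \<in> borel_measurable borel"
    by (rule borel_measurable_nn_integral_sphere) measurable
  have "(\<integral>\<^sup>+r\<in>{0<..}. ennreal_powr (\<integral>\<^sup>+\<theta>. ennreal (cmod (f (r *\<^sub>R \<theta>)) powr q) \<partial>sphere_measure) (p / q)
            * ennreal (r ^ (DIM('a) - 1)) \<partial>lborel)
      = (\<integral>\<^sup>+r\<in>{0<..}. ennreal_powr (?F r) (p / q) * ennreal (r ^ (DIM('a) - 1)) \<partial>lborel)"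
  proof (rule nn_integral_cong_AE)
    have "AE r in lborel. 0 < r \<longrightarrow> (AE \<theta> in sphere_measure. f (r *\<^sub>R \<theta>) = g (r *\<^sub>R \<theta>))"
      using AE_polar(1)[OF ae] by (simp add: AE_mult_haar)
    then show "AE r in lborel. ennreal_powr (\<integral>\<^sup>+\<theta>. ennreal (cmod (f (r *\<^sub>R \<theta>)) powr q) \<partial>sphere_measure) (p / q)
            * ennreal (r ^ (DIM('a) - 1)) * indicator {0<..} r
        = ennreal_powr (?F r) (p / q) * ennreal (r ^ (DIM('a) - 1)) * indicator {0<..} r"
    proof eventually_elim
      case (elim r)
      show ?case
      proof (cases "0 < r")
        case True
        have "(\<integral>\<^sup>+\<theta>. ennreal (cmod (f (r *\<^sub>R \<theta>)) powr q) \<partial>sphere_measure) = ?F r"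
          by (rule nn_integral_cong_AE, rule eventually_mono[OF elim[rule_format, OF True]])
             (simp add: ennreal_powr_ennreal)
        then show ?thesis by simp
      qed simp
    qed
  qed
  also have "\<dots> = (\<integral>\<^sup>+r. ennreal_powr (?F r) (p / q) * ennreal (r ^ DIM('a)) \<partial>mult_haar)"
    unfolding nn_integral_completion[of lborel, symmetric]
    by (rule radial_integral_eq_mult_haar[OF measurable_compose[OF F measurable_ennreal_powr]]) simp
  finally show ?thesis
    by (simp add: radang_norm_def nn_integral_completion)
qed

lemma radang_norm_le:
  fixes h :: "'a::euclidean_space \<Rightarrow> complex"
  assumes [measurable]: "K \<in> borel_measurable borel"
    and le: "\<And>x. x \<noteq> 0 \<Longrightarrow> ennreal (cmod (h x)) \<le> K (norm x)"
    and pq: "0 < p" "0 < q"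
  shows "radang_norm p q h
    \<le> ennreal_powr (emeasure (sphere_measure :: 'a measure) (sphere 0 1)) (1 / q)
      * ennreal_powr (\<integral>\<^sup>+r. ennreal_powr (K r) p * ennreal (r ^ DIM('a)) \<partial>mult_haar) (1 / p)"
proof -
  define W where "W = emeasure (sphere_measure :: 'a measure) (sphere 0 1)"
  let ?I = "\<integral>\<^sup>+r. ennreal_powr (K r) p * ennreal (r ^ DIM('a)) \<partial>mult_haar"
  have "(\<integral>\<^sup>+r\<in>{0<..}. ennreal_powr (\<integral>\<^sup>+\<theta>. ennreal (cmod (h (r *\<^sub>R \<theta>)) powr q) \<partial>sphere_measure) (p / q)
            * ennreal (r ^ (DIM('a) - 1)) \<partial>lebesgue)
      \<le> (\<integral>\<^sup>+r\<in>{0<..}. (ennreal_powr W (p / q) * ennreal_powr (K r) p) * ennreal (r ^ (DIM('a) - 1)) \<partial>lebesgue)"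
  proof (rule nn_integral_mono)
    fix r :: real
    show "ennreal_powr (\<integral>\<^sup>+\<theta>. ennreal (cmod (h (r *\<^sub>R \<theta>)) powr q) \<partial>sphere_measure) (p / q)
            * ennreal (r ^ (DIM('a) - 1)) * indicator {0<..} r
        \<le> (ennreal_powr W (p / q) * ennreal_powr (K r) p) * ennreal (r ^ (DIM('a) - 1)) * indicator {0<..} r"
    proof (cases "0 < r")
      case True
      have "(\<integral>\<^sup>+\<theta>. ennreal (cmod (h (r *\<^sub>R \<theta>)) powr q) \<partial>sphere_measure)
          \<le> (\<integral>\<^sup>+\<theta>. ennreal_powr (K r) q \<partial>(sphere_measure :: 'a measure))"
      proof (rule nn_integral_mono)
        fix \<theta> :: 'a assume "\<theta> \<in> space sphere_measure"
        then have \<theta>: "norm \<theta> = 1" by simp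
        then have "r *\<^sub>R \<theta> \<noteq> 0"
          using True by auto
        then have "ennreal (cmod (h (r *\<^sub>R \<theta>))) \<le> K r"
          using le[of "r *\<^sub>R \<theta>"] True \<theta> by simp
        then show "ennreal (cmod (h (r *\<^sub>R \<theta>)) powr q) \<le> ennreal_powr (K r) q"
          using ennreal_powr_mono[of _ "K r" q] pq by (simp add: ennreal_powr_ennreal[symmetric])
      qed
      also have "\<dots> = ennreal_powr (K r) q * W"
        by (simp add: W_def)
      finally have "ennreal_powr (\<integral>\<^sup>+\<theta>. ennreal (cmod (h (r *\<^sub>R \<theta>)) powr q) \<partial>sphere_measure) (p / q)
          \<le> ennreal_powr (ennreal_powr (K r) q * W) (p / q)"
        using pq by (intro ennreal_powr_mono) auto
      also have "\<dots> = ennreal_powr W (p / q) * ennreal_powr (K r) p"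
        using pq by (simp add: ennreal_powr_mult ennreal_powr_powr mult.commute)
      finally show ?thesis
        by (intro mult_right_mono) auto
    qed simp
  qed
  also have "\<dots> = (\<integral>\<^sup>+r. (ennreal_powr W (p / q) * ennreal_powr (K r) p) * ennreal (r ^ DIM('a)) \<partial>mult_haar)"
    by (rule radial_integral_eq_mult_haar) simp_all
  also have "\<dots> = ennreal_powr W (p / q) * ?I"
    unfolding mult.assoc by (rule nn_integral_cmult) measurable
  finally have "radang_norm p q h \<le> ennreal_powr (ennreal_powr W (p / q) * ?I) (1 / p)"
    unfolding radang_norm_def using pq by (intro ennreal_powr_mono) auto
  then show ?thesis
    using pq by (simp add: ennreal_powr_mult ennreal_powr_powr W_def)
qed

subsection \<open>The Hausdorff operator\<close>

definition hausdorff_majorant :: "(real \<Rightarrow> complex) \<Rightarrow> ('a::euclidean_space \<Rightarrow> complex) \<Rightarrow> real \<Rightarrow> ennreal" where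
  "hausdorff_majorant \<psi> g r = (\<integral>\<^sup>+s. ennreal (cmod (\<psi> (r / s)))
      * (\<integral>\<^sup>+\<theta>. ennreal (cmod (g (s *\<^sub>R \<theta>))) \<partial>sphere_measure) \<partial>mult_haar)"

lemma measurable_spherical_l1 [measurable]:
  fixes g :: "'a::euclidean_space \<Rightarrow> complex"
  assumes [measurable]: "g \<in> borel_measurable borel"
  shows "(\<lambda>s. \<integral>\<^sup>+\<theta>. ennreal (cmod (g (s *\<^sub>R \<theta>))) \<partial>sphere_measure) \<in> borel_measurable borel"
  by (rule borel_measurable_nn_integral_sphere) measurable

lemma measurable_hausdorff_majorant:
  fixes g :: "'a::euclidean_space \<Rightarrow> complex"
  assumes [measurable]: "\<psi> \<in> borel_measurable borel" "g \<in> borel_measurable borel"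
  shows "hausdorff_majorant \<psi> g \<in> borel_measurable borel"
proof -
  note [measurable] = measurable_spherical_l1[OF assms(2)]
  show ?thesis
    unfolding hausdorff_majorant_def[abs_def]
    by measurable
qed

context
  fixes \<Phi> f g :: "'a::euclidean_space \<Rightarrow> complex" and \<psi> :: "real \<Rightarrow> complex"
  assumes radial: "radial \<Phi>"
    and \<psi> [measurable]: "\<psi> \<in> borel_measurable borel"
    and g [measurable]: "g \<in> borel_measurable borel"
    and \<Phi>\<psi>: "AE t in mult_haar. radial_value \<Phi> t = \<psi> t"
    and fg: "AE x in lborel. f x = g x"
begin

private definition k :: "'a \<Rightarrow> 'a \<Rightarrow> complex" where
  "k x y = \<psi> (norm x / norm y) / complex_of_real (norm y ^ DIM('a)) * g y"

private lemma k_measurable: "(\<lambda>(x, y). k x y) \<in> borel_measurable (borel \<Otimes>\<^sub>M borel)"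
  unfolding k_def by measurable

private lemma k_measurable' [measurable]: "k x \<in> borel_measurable borel"
  unfolding k_def[abs_def] by measurable

private lemma AE_k:
  assumes "x \<noteq> 0"
  shows "AE y in lborel. k x y = hausdorff_kernel \<Phi> x y * f y"
proof -
  have "AE y in (lborel :: 'a measure). radial_value \<Phi> (norm x / norm y) = \<psi> (norm x / norm y)"
    using assms by (intro AE_norm[OF AE_mult_haar_reflect[OF \<Phi>\<psi>]]) simp
  with fg show ?thesis
  proof eventually_elim
    case (elim y)
    have "norm (x /\<^sub>R norm y) = norm x / norm y"
      by (simp add: field_simps)
    then show ?case
      using elim radial_value_norm[OF radial, of "x /\<^sub>R norm y"] by (simp add: k_def hausdorff_kernel_def)
  qed
qed

private lemma nn_integral_k:
  "(\<integral>\<^sup>+y. ennreal (cmod (k x y)) \<partial>lborel) = hausdorff_majorant \<psi> g (norm x)"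
proof -
  have "(\<integral>\<^sup>+y. ennreal (cmod (k x y)) \<partial>lborel)
      = (\<integral>\<^sup>+s. ennreal (s ^ DIM('a)) * (\<integral>\<^sup>+\<theta>. ennreal (cmod (k x (s *\<^sub>R \<theta>))) \<partial>sphere_measure) \<partial>mult_haar)"
    by (rule nn_integral_polar) measurable
  also have "\<dots> = hausdorff_majorant \<psi> g (norm x)"
    unfolding hausdorff_majorant_def
  proof (rule nn_integral_cong_AE, rule eventually_mono[OF AE_mult_haar_pos])
    fix s :: real assume s: "0 < s"
    have "(\<integral>\<^sup>+\<theta>. ennreal (cmod (k x (s *\<^sub>R \<theta>))) \<partial>sphere_measure)
        = (\<integral>\<^sup>+\<theta>. ennreal (cmod (\<psi> (norm x / s)) / s ^ DIM('a)) * ennreal (cmod (g (s *\<^sub>R \<theta>))) \<partial>sphere_measure)"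
      using s by (intro nn_integral_cong)
        (simp add: k_def norm_mult norm_divide norm_power flip: ennreal_mult)
    also have "\<dots> = ennreal (cmod (\<psi> (norm x / s)) / s ^ DIM('a)) * (\<integral>\<^sup>+\<theta>. ennreal (cmod (g (s *\<^sub>R \<theta>))) \<partial>sphere_measure)"
      by (rule nn_integral_cmult, rule measurable_scaleR_sphere') measurable
    finally show "ennreal (s ^ DIM('a)) * (\<integral>\<^sup>+\<theta>. ennreal (cmod (k x (s *\<^sub>R \<theta>))) \<partial>sphere_measure)
        = ennreal (cmod (\<psi> (norm x / s))) * (\<integral>\<^sup>+\<theta>. ennreal (cmod (g (s *\<^sub>R \<theta>))) \<partial>sphere_measure)"
      using s by (simp add: mult.assoc[symmetric] flip: ennreal_mult)
  qed
  finally show ?thesis .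
qed

private lemma kernel_measurable:
  assumes "x \<noteq> 0"
  shows "(\<lambda>y. hausdorff_kernel \<Phi> x y * f y) \<in> borel_measurable lebesgue"
  using AE_completion[OF AE_k[OF assms]]
  by (rule borel_measurable_AE[rotated]) (simp add: measurable_completion)

private lemma hausdorff_op_eq:
  assumes "x \<noteq> 0"
  shows "hausdorff_op \<Phi> f x = (LINT y|lborel. k x y)"
proof -
  have "hausdorff_op \<Phi> f x = (LINT y|lebesgue. k x y)"
    unfolding hausdorff_op_def
    by (rule integral_cong_AE, rule kernel_measurable[OF assms], simp add: measurable_completion)
       (use AE_completion[OF AE_k[OF assms]] in eventually_elim, simp)
  then show ?thesis
    by (simp add: integral_completion)
qed

lemma hausdorff_op_measurable: "hausdorff_op \<Phi> f \<in> borel_measurable lebesgue"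
proof (rule borel_measurable_AE)
  have "(\<lambda>x. LINT y|lborel. k x y) \<in> borel_measurable borel"
    using k_measurable by (intro lborel.borel_measurable_lebesgue_integral) simp
  then show "(\<lambda>x. LINT y|lborel. k x y) \<in> borel_measurable lebesgue"
    by (simp add: measurable_completion)
  have "AE x in lborel. (LINT y|lborel. k x y) = hausdorff_op \<Phi> f x"
    using AE_lborel_singleton[of 0] by eventually_elim (simp add: hausdorff_op_eq)
  then show "AE x in lebesgue. (LINT y|lborel. k x y) = hausdorff_op \<Phi> f x"
    by (rule AE_completion)
qed

lemma cmod_hausdorff_op_le:
  assumes "x \<noteq> 0"
  shows "ennreal (cmod (hausdorff_op \<Phi> f x)) \<le> hausdorff_majorant \<psi> g (norm x)"
proof (cases "integrable lborel (k x)")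
  case True
  then have "ennreal (norm (LINT y|lborel. k x y)) \<le> (\<integral>\<^sup>+y. ennreal (cmod (k x y)) \<partial>lborel)"
    by (rule integral_norm_bound_ennreal)
  then show ?thesis
    by (simp add: hausdorff_op_eq[OF assms] nn_integral_k)
next
  case False
  then show ?thesis
    by (simp add: hausdorff_op_eq[OF assms] not_integrable_integral_eq)
qed

lemma integrable_hausdorff_kernel:
  assumes "x \<noteq> 0" and "hausdorff_majorant \<psi> g (norm x) \<noteq> top"
  shows "integrable lebesgue (\<lambda>y. hausdorff_kernel \<Phi> x y * f y)"
proof -
  have "integrable lborel (k x)"
    using assms(2) by (intro integrableI_bounded) (simp_all add: nn_integral_k top.not_eq_extremum)
  then have "integrable lebesgue (k x)"
    by (simp add: integrable_completion)
  then show ?thesis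
    by (rule integrable_cong_AE_imp[OF _ kernel_measurable[OF assms(1)]])
       (use AE_completion[OF AE_k[OF assms(1)]] in eventually_elim, simp)
qed

end

lemma spherical_l1_powr_le:
  fixes g :: "'a::euclidean_space \<Rightarrow> complex"
  assumes [measurable]: "g \<in> borel_measurable borel" and q: "1 \<le> q" and p: "0 < p"
  shows "ennreal_powr (\<integral>\<^sup>+\<theta>. ennreal (cmod (g (s *\<^sub>R \<theta>))) \<partial>sphere_measure) p
    \<le> ennreal (measure (sphere_measure :: 'a measure) (sphere 0 1) powr (p * (1 - 1 / q)))
      * ennreal_powr (\<integral>\<^sup>+\<theta>. ennreal_powr (ennreal (cmod (g (s *\<^sub>R \<theta>)))) q \<partial>sphere_measure) (p / q)"
    (is "ennreal_powr ?G p \<le> _ * ennreal_powr ?F _")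
proof -
  let ?w = "measure (sphere_measure :: 'a measure) (sphere 0 1)"
  have w: "emeasure (sphere_measure :: 'a measure) (sphere 0 1) = ennreal ?w"
    by (rule sphere_measure.emeasure_eq_measure)
  have "(\<lambda>\<theta>. ennreal (cmod (g (s *\<^sub>R \<theta>)))) \<in> borel_measurable sphere_measure"
    by (rule measurable_scaleR_sphere') measurable
  from nn_integral_powr_le[OF this q]
  have "ennreal_powr ?G q \<le> ennreal (?w powr (q - 1)) * ?F"
    by (simp add: w ennreal_powr_ennreal)
  then have "ennreal_powr (ennreal_powr ?G q) (p / q) \<le> ennreal_powr (ennreal (?w powr (q - 1)) * ?F) (p / q)"
    using p q by (intro ennreal_powr_mono) auto
  also have "\<dots> = ennreal (?w powr ((q - 1) * (p / q))) * ennreal_powr ?F (p / q)"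
    using p q by (simp add: ennreal_powr_mult ennreal_powr_ennreal powr_powr)
  also have "(q - 1) * (p / q) = p * (1 - 1 / q)"
    using q by (simp add: field_simps)
  finally show ?thesis
    using q by (simp add: ennreal_powr_powr)
qed

lemma nn_integral_hausdorff_majorant_le:
  fixes g :: "'a::euclidean_space \<Rightarrow> complex" and \<psi> :: "real \<Rightarrow> complex"
  assumes [measurable]: "\<psi> \<in> borel_measurable borel" "g \<in> borel_measurable borel"
    and p: "1 \<le> p" and fin: "(\<integral>\<^sup>+t. ennreal (cmod (\<psi> t) * t powr (DIM('a) / p)) \<partial>mult_haar) \<noteq> top"
  shows "(\<integral>\<^sup>+r. ennreal_powr (hausdorff_majorant \<psi> g r) p * ennreal (r ^ DIM('a)) \<partial>mult_haar)
    \<le> ennreal_powr (\<integral>\<^sup>+t. ennreal (cmod (\<psi> t) * t powr (DIM('a) / p)) \<partial>mult_haar) p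
      * (\<integral>\<^sup>+s. ennreal_powr (\<integral>\<^sup>+\<theta>. ennreal (cmod (g (s *\<^sub>R \<theta>))) \<partial>sphere_measure) p * ennreal (s ^ DIM('a)) \<partial>mult_haar)"
proof -
  define a where "a = DIM('a) / p"
  define G where "G s = (\<integral>\<^sup>+\<theta>. ennreal (cmod (g (s *\<^sub>R \<theta>))) \<partial>(sphere_measure :: 'a measure))" for s
  define w where "w t = ennreal (cmod (\<psi> t) * t powr a)" for t
  have [measurable]: "G \<in> borel_measurable borel"
    unfolding G_def[abs_def] by (rule measurable_spherical_l1) measurable
  have [measurable]: "w \<in> borel_measurable borel"
    unfolding w_def[abs_def] by measurable
  have pw: "ennreal_powr (ennreal (s powr a) * X) p = ennreal_powr X p * ennreal (s ^ DIM('a))"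
    if "0 < s" for s X
    using p that by (simp add: ennreal_powr_mult ennreal_powr_ennreal powr_powr a_def powr_realpow mult.commute)
  have "(\<integral>\<^sup>+r. ennreal_powr (hausdorff_majorant \<psi> g r) p * ennreal (r ^ DIM('a)) \<partial>mult_haar)
      = (\<integral>\<^sup>+r. ennreal_powr (\<integral>\<^sup>+s. w (r / s) * (ennreal (s powr a) * G s) \<partial>mult_haar) p \<partial>mult_haar)"
  proof (rule nn_integral_cong_AE, rule eventually_mono[OF AE_mult_haar_pos])
    fix r :: real assume r: "0 < r"
    have "ennreal (r powr a) * hausdorff_majorant \<psi> g r
        = (\<integral>\<^sup>+s. ennreal (r powr a) * (ennreal (cmod (\<psi> (r / s))) * G s) \<partial>mult_haar)"
      unfolding hausdorff_majorant_def G_def[symmetric] by (rule nn_integral_cmult[symmetric]) measurable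
    also have "\<dots> = (\<integral>\<^sup>+s. w (r / s) * (ennreal (s powr a) * G s) \<partial>mult_haar)"
    proof (rule nn_integral_cong_AE, rule eventually_mono[OF AE_mult_haar_pos])
      fix s :: real assume s: "0 < s"
      then have "ennreal (r powr a) * ennreal (cmod (\<psi> (r / s))) = w (r / s) * ennreal (s powr a)"
        using r by (simp add: w_def powr_divide flip: ennreal_mult)
      then show "ennreal (r powr a) * (ennreal (cmod (\<psi> (r / s))) * G s) = w (r / s) * (ennreal (s powr a) * G s)"
        by (simp add: mult.assoc[symmetric])
    qed
    finally show "ennreal_powr (hausdorff_majorant \<psi> g r) p * ennreal (r ^ DIM('a))
        = ennreal_powr (\<integral>\<^sup>+s. w (r / s) * (ennreal (s powr a) * G s) \<partial>mult_haar) p"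
      using pw[OF r] by metis
  qed
  also have "\<dots> \<le> ennreal_powr (\<integral>\<^sup>+t. w t \<partial>mult_haar) p
      * (\<integral>\<^sup>+s. ennreal_powr (ennreal (s powr a) * G s) p \<partial>mult_haar)"
    using fin p by (intro nn_integral_mult_conv_powr_le) (auto simp: w_def a_def)
  also have "(\<integral>\<^sup>+s. ennreal_powr (ennreal (s powr a) * G s) p \<partial>mult_haar)
      = (\<integral>\<^sup>+s. ennreal_powr (G s) p * ennreal (s ^ DIM('a)) \<partial>mult_haar)"
    by (rule nn_integral_cong_AE, rule eventually_mono[OF AE_mult_haar_pos]) (rule pw)
  finally show ?thesis
    by (simp add: w_def a_def G_def)
qed

lemma hausdorff_radang_bound:
  fixes \<Phi> f :: "'a::euclidean_space \<Rightarrow> complex" and p q1 q2 :: real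
  assumes \<Phi>: "\<Phi> \<in> borel_measurable lebesgue" "radial \<Phi>"
    and p: "1 \<le> p" and q: "1 \<le> q1" "1 \<le> q2"
    and f: "f \<in> radang_space p q2"
  shows "hausdorff_const \<Phi> p < \<infinity> \<Longrightarrow> AE x in lebesgue. integrable lebesgue (\<lambda>y. hausdorff_kernel \<Phi> x y * f y)"
    and "hausdorff_op \<Phi> f \<in> borel_measurable lebesgue"
    and "radang_norm p q1 (hausdorff_op \<Phi> f)
      \<le> ennreal (measure (sphere_measure :: 'a measure) (sphere 0 1) powr (1 / q1 + (1 - 1 / q2)))
        * hausdorff_const \<Phi> p * radang_norm p q2 f"
proof -
  from f have "f \<in> borel_measurable lebesgue" and fnorm: "radang_norm p q2 f < \<infinity>"
    by (auto simp: radang_space_def)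
  then obtain g where g [measurable]: "g \<in> borel_measurable borel" and fg: "AE x in lborel. f x = g x"
    using lebesgue_measurable_ex_borel by blast
  obtain \<psi> where \<psi> [measurable]: "\<psi> \<in> borel_measurable borel"
    and \<Phi>\<psi>: "AE t in mult_haar. radial_value \<Phi> t = \<psi> t"
    using radial_value_ex_borel[OF \<Phi>] by blast
  define w where "w = measure (sphere_measure :: 'a measure) (sphere 0 1)"
  have emw: "emeasure (sphere_measure :: 'a measure) (sphere 0 1) = ennreal w"
    unfolding w_def by (rule sphere_measure.emeasure_eq_measure)
  have w: "0 < w"
    using unit_ball_vol_pos[of "DIM('a)"] by (simp add: w_def measure_def emeasure_sphere_measure_UNIV)
  define K where "K = hausdorff_majorant \<psi> g"
  have [measurable]: "K \<in> borel_measurable borel"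
    unfolding K_def by (rule measurable_hausdorff_majorant) measurable
  define F where "F r = (\<integral>\<^sup>+\<theta>. ennreal_powr (ennreal (cmod (g (r *\<^sub>R \<theta>)))) q2 \<partial>(sphere_measure :: 'a measure))" for r
  have [measurable]: "F \<in> borel_measurable borel"
    unfolding F_def[abs_def] by (rule borel_measurable_nn_integral_sphere) measurable
  define G where "G s = (\<integral>\<^sup>+\<theta>. ennreal (cmod (g (s *\<^sub>R \<theta>))) \<partial>(sphere_measure :: 'a measure))" for s
  have [measurable]: "G \<in> borel_measurable borel"
    unfolding G_def[abs_def] by (rule measurable_spherical_l1) measurable
  define N where "N = (\<integral>\<^sup>+r. ennreal_powr (F r) (p / q2) * ennreal (r ^ DIM('a)) \<partial>mult_haar)"
  define J where "J = (\<integral>\<^sup>+r. ennreal_powr (K r) p * ennreal (r ^ DIM('a)) \<partial>mult_haar)"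
  define C where "C = hausdorff_const \<Phi> p"
  have C: "C = (\<integral>\<^sup>+t. ennreal (cmod (\<psi> t) * t powr (DIM('a) / p)) \<partial>mult_haar)"
    unfolding C_def by (rule hausdorff_const_eq[OF \<psi> \<Phi>\<psi>])
  have norm_f: "radang_norm p q2 f = ennreal_powr N (1 / p)"
    unfolding N_def F_def by (rule radang_norm_eq[OF g fg])
  then have N: "N \<noteq> top"
    using fnorm by auto
  note le = cmod_hausdorff_op_le[OF \<Phi>(2) \<psi> g \<Phi>\<psi> fg, folded K_def]
  have norm_H: "radang_norm p q1 (hausdorff_op \<Phi> f) \<le> ennreal (w powr (1 / q1)) * ennreal_powr J (1 / p)"
    using radang_norm_le[of K "hausdorff_op \<Phi> f" p q1, OF _ le] p q w
    by (simp add: J_def emw ennreal_powr_ennreal)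
  have GF: "ennreal_powr (G s) p \<le> ennreal (w powr (p * (1 - 1 / q2))) * ennreal_powr (F s) (p / q2)" for s
    unfolding G_def F_def w_def using p q by (intro spherical_l1_powr_le) auto
  have J: "J \<le> ennreal_powr C p * (ennreal (w powr (p * (1 - 1 / q2))) * N)" if "C \<noteq> top"
  proof -
    have "J \<le> ennreal_powr C p * (\<integral>\<^sup>+s. ennreal_powr (G s) p * ennreal (s ^ DIM('a)) \<partial>mult_haar)"
      unfolding J_def K_def C G_def using p that by (intro nn_integral_hausdorff_majorant_le) (auto simp: C)
    also have "(\<integral>\<^sup>+s. ennreal_powr (G s) p * ennreal (s ^ DIM('a)) \<partial>mult_haar)
        \<le> (\<integral>\<^sup>+s. ennreal (w powr (p * (1 - 1 / q2))) * (ennreal_powr (F s) (p / q2) * ennreal (s ^ DIM('a))) \<partial>mult_haar)"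
      unfolding mult.assoc[symmetric] by (intro nn_integral_mono mult_right_mono GF) auto
    also have "\<dots> = ennreal (w powr (p * (1 - 1 / q2))) * N"
      unfolding N_def by (rule nn_integral_cmult) measurable
    finally show ?thesis by (simp add: mult_left_mono)
  qed
  show "hausdorff_op \<Phi> f \<in> borel_measurable lebesgue"
    by (rule hausdorff_op_measurable[OF \<Phi>(2) \<psi> g \<Phi>\<psi> fg])
  show "AE x in lebesgue. integrable lebesgue (\<lambda>y. hausdorff_kernel \<Phi> x y * f y)" if "hausdorff_const \<Phi> p < \<infinity>"
  proof (rule AE_completion)
    have "C \<noteq> top" using that by (simp add: C_def)
    then have "J \<noteq> \<infinity>"
      using J N by (auto simp: ennreal_mult_eq_top_iff ennreal_powr_eq_top_iff top_unique)
    then have "AE r in mult_haar. ennreal_powr (K r) p * ennreal (r ^ DIM('a)) \<noteq> \<infinity>"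
      unfolding J_def by (rule nn_integral_PInf_AE[rotated]) measurable
    with AE_mult_haar_pos have "AE r in mult_haar. K r \<noteq> top"
      by eventually_elim (auto simp: ennreal_top_mult)
    then have "AE x in (lborel :: 'a measure). K (norm x) \<noteq> top"
      by (rule AE_norm)
    with AE_lborel_singleton[of 0]
    show "AE x in lborel. integrable lebesgue (\<lambda>y. hausdorff_kernel \<Phi> x y * f y)"
      by eventually_elim (rule integrable_hausdorff_kernel[OF \<Phi>(2) \<psi> g \<Phi>\<psi> fg, folded K_def])
  qed
  have "ennreal (w powr (1 / q1)) * ennreal_powr J (1 / p)
      \<le> ennreal (w powr (1 / q1 + (1 - 1 / q2))) * C * ennreal_powr N (1 / p)"
  proof (cases "C = top")
    case False
    have "ennreal_powr J (1 / p) \<le> ennreal_powr (ennreal_powr C p * (ennreal (w powr (p * (1 - 1 / q2))) * N)) (1 / p)"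
      using p J[OF False] by (intro ennreal_powr_mono) auto
    also have "\<dots> = C * (ennreal (w powr (1 - 1 / q2)) * ennreal_powr N (1 / p))"
      using p by (simp add: ennreal_powr_mult ennreal_powr_powr ennreal_powr_ennreal powr_powr)
    finally have "ennreal (w powr (1 / q1)) * ennreal_powr J (1 / p)
        \<le> ennreal (w powr (1 / q1)) * (C * (ennreal (w powr (1 - 1 / q2)) * ennreal_powr N (1 / p)))"
      by (rule mult_left_mono) simp
    also have "\<dots> = ennreal (w powr (1 / q1)) * ennreal (w powr (1 - 1 / q2)) * C * ennreal_powr N (1 / p)"
      by (simp only: ac_simps)
    also have "ennreal (w powr (1 / q1)) * ennreal (w powr (1 - 1 / q2)) = ennreal (w powr (1 / q1 + (1 - 1 / q2)))"
      using w by (simp add: powr_add flip: ennreal_mult)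
    finally show ?thesis .
  next
    case C_top: True
    show ?thesis
    proof (cases "N = 0")
      case False
      then have "ennreal_powr N (1 / p) \<noteq> 0"
        by (simp add: ennreal_powr_eq_0_iff)
      then show ?thesis
        using w C_top by (simp add: ennreal_mult_top ennreal_top_mult)
    next
      case True
      then have "AE r in mult_haar. ennreal_powr (F r) (p / q2) * ennreal (r ^ DIM('a)) = 0"
        unfolding N_def by (rule nn_integral_0_iff_AE[THEN iffD1, rotated]) measurable
      with AE_mult_haar_pos have "AE s in mult_haar. G s = 0"
      proof eventually_elim
        case (elim s)
        then have "ennreal_powr (F s) (p / q2) = 0" by simp
        then have "ennreal_powr (G s) p \<le> 0" using GF[of s] by simp
        then show ?case by (simp add: ennreal_powr_eq_0_iff)
      qed
      then have "K r = (\<integral>\<^sup>+s. 0 \<partial>mult_haar)" for r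
        unfolding K_def hausdorff_majorant_def G_def[symmetric]
        by (intro nn_integral_cong_AE) (elim eventually_mono, simp)
      then have "J = 0" by (simp add: J_def)
      then show ?thesis by simp
    qed
  qed
  with norm_H show "radang_norm p q1 (hausdorff_op \<Phi> f)
      \<le> ennreal (measure (sphere_measure :: 'a measure) (sphere 0 1) powr (1 / q1 + (1 - 1 / q2)))
        * hausdorff_const \<Phi> p * radang_norm p q2 f"
    unfolding w_def[symmetric] C_def[symmetric] norm_f by (rule order_trans)
qed

theorem theorem1p1:
  fixes \<Phi> f :: "real ^ 'n \<Rightarrow> complex" and p q1 q2 :: real
  assumes "CARD('n) \<ge> 2"
    and "\<Phi> \<in> borel_measurable lebesgue" and "radial \<Phi>"
    and "1 \<le> p" and "1 \<le> q1" and "1 \<le> q2"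
    and "f \<in> radang_space p q2"
  shows "(hausdorff_const \<Phi> p < \<infinity> \<longrightarrow>
            (AE x in lebesgue. integrable lebesgue (\<lambda>y. hausdorff_kernel \<Phi> x y * f y)) \<and>
            hausdorff_op \<Phi> f \<in> borel_measurable lebesgue) \<and>
         radang_norm p q1 (hausdorff_op \<Phi> f)
           \<le> ennreal (measure (sphere_measure :: (real ^ 'n) measure) (sphere 0 1)
                        powr (1 / q1 + (1 - 1 / q2)))
             * hausdorff_const \<Phi> p * radang_norm p q2 f"
  using hausdorff_radang_bound[OF assms(2-7)] by blast

end
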